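(* Let $(\phi_t)_{t\ge0}$ be a continuous one-parameter semigroup of holomorphic functions in the unit disk $\mathbb{D}$ with Koenigs function $h$ and Koenigs domain $\Omega=h(\mathbb{D})$. Let $z\in\mathbb{D}$ and let $\tilde\gamma_z:[0,T_z)\to\mathbb{D}$, $\tilde\gamma_z(t)=\phi_t^{-1}(z)$, be the backward orbit of $z$. (a) Suppose $(\phi_t)$ is non-elliptic. Then $\tilde\gamma_z$ is Lipschitz if and only if $$\limsup_{t\to T_z}\frac{\lambda_\Omega(h(z)-t)}{e^{2k_\Omega(h(z),\,h(z)-t)}}<+\infty.$$ (b) Suppose $(\phi_t)$ is elliptic with Denjoy-Wolff point $\tau\in\mathbb{D}$ and spectral value $\mu\in\mathbb{C}$, $\mathrm{Re}\,\mu>0$, and that $z\neq\tau$. Then $\tilde\gamma_z$ is Lipschitz if and only if $$\limsup_{t\to T_z}\frac{e^{(\mathrm{Re}\,\mu) t}\,\lambda_\Omega(e^{\mu t}h(z))}{e^{2k_\Omega(h(z),\,e^{\mu t}h(z))}}<+\infty.$$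
   Context: A (continuous one-parameter) semigroup in $\mathbb{D}$ is a family $(\phi_t)_{t\ge0}$ of holomorphic functions $\phi_t:\mathbb{D}\to\mathbb{D}$ such that $\phi_0=\mathrm{id}_{\mathbb{D}}$, $\phi_{t+s}=\phi_t\circ\phi_s$ for all $t,s\ge0$, and $\phi_t\to\phi_0$ locally uniformly as $t\to0^+$; every $\phi_t$ is univalent. If $(\phi_t)$ is not a group of hyperbolic rotations (including the trivial semigroup), there is a unique $\tau\in\overline{\mathbb{D}}$ (Denjoy-Wolff point) with $\phi_t(z)\to\tau$ as $t\to+\infty$ for all $z\in\mathbb{D}$; $(\phi_t)$ is elliptic if $\tau\in\mathbb{D}$ and non-elliptic if $\tau\in\partial\mathbb{D}$. Koenigs function: if $(\phi_t)$ is elliptic, it is the conformal map $h:\mathbb{D}\to\mathbb{C}$ onto its image (unique up to a multiplicative constant) with $h(\tau)=0$ and $h(\phi_t(z))=e^{-\mu t}h(z)$ for all $t\ge0$, $z\in\mathbb{D}$, where $\mu$, $\mathrm{Re}\,\mu>0$, is the spectral value, i.e. the unique complex number with $\phi_t'(\tau)=e^{-\mu t}$ for all $t\ge0$. If $(\phi_t)$ is non-elliptic, it is the conformal map $h:\mathbb{D}\to\mathbb{C}$ onto its image (unique up to an additive constant) with $h(\phi_t(z))=h(z)+t$ for all $t\ge0$, $z\in\mathbb{D}$. The Koenigs domain is $\Omega=h(\mathbb{D})$. For $z\in\mathbb{D}$, $T_z\in(0,+\infty]$ is the supremum of all $T>0$ such that $z\in\phi_t(\mathbb{D})$ for every $t\in[0,T)$.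 Hyperbolic quantities: $\lambda_{\mathbb{D}}(z)=\frac{1}{1-|z|^2}$ and $k_{\mathbb{D}}(z,w)=\frac12\log\frac{|1-\bar z w|+|z-w|}{|1-\bar z w|-|z-w|}$. For a simply connected domain $\Omega\subsetneq\mathbb{C}$ with Riemann map $f:\Omega\to\mathbb{D}$, $\lambda_\Omega(z)=\lambda_{\mathbb{D}}(f(z))|f'(z)|$ and $k_\Omega(z,w)=k_{\mathbb{D}}(f(z),f(w))$ (independent of $f$). A function $\gamma:I\to\mathbb{C}$ on an interval $I\subset\mathbb{R}$ is Lipschitz if there is $C>0$ with $|\gamma(t)-\gamma(s)|\le C|t-s|$ for all $t,s\in I$. *)

theory Defs
  imports "HOL-Complex_Analysis.Complex_Analysis"
begin

abbreviation unit_disc :: "complex set" where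
  "unit_disc \<equiv> ball 0 1"

text \<open>Only the values \<open>\<phi> t z\<close> with \<open>t \<ge> 0\<close> and \<open>z\<close> in the unit disc are meaningful; the others
  are unconstrained. Univalence of the \<open>\<phi> t\<close> is a consequence and hence not required.\<close>

definition holomorphic_semigroup :: "(real \<Rightarrow> complex \<Rightarrow> complex) \<Rightarrow> bool" where
  "holomorphic_semigroup \<phi> \<longleftrightarrow>
     (\<forall>t\<ge>0. \<phi> t holomorphic_on unit_disc \<and> \<phi> t ` unit_disc \<subseteq> unit_disc) \<and>
     (\<forall>z\<in>unit_disc. \<phi> 0 z = z) \<and>
     (\<forall>t\<ge>0. \<forall>s\<ge>0. \<forall>z\<in>unit_disc. \<phi> (t + s) z = \<phi> t (\<phi> s z)) \<and>
     (\<forall>K. compact K \<and> K \<subseteq> unit_disc \<longrightarrow> uniform_limit K \<phi> (\<phi> 0) (at_right 0))"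

text \<open>A group of hyperbolic rotations (in particular the trivial semigroup) has no Denjoy-Wolff
  point in the sense below: its orbits do not all converge to one and the same point.\<close>

definition denjoy_wolff_point :: "(real \<Rightarrow> complex \<Rightarrow> complex) \<Rightarrow> complex \<Rightarrow> bool" where
  "denjoy_wolff_point \<phi> \<tau> \<longleftrightarrow>
     \<tau> \<in> cball 0 1 \<and> (\<forall>z\<in>unit_disc. ((\<lambda>t. \<phi> t z) \<longlongrightarrow> \<tau>) at_top)"

definition non_elliptic :: "(real \<Rightarrow> complex \<Rightarrow> complex) \<Rightarrow> bool" where
  "non_elliptic \<phi> \<longleftrightarrow> (\<exists>\<tau>. denjoy_wolff_point \<phi> \<tau> \<and> \<tau> \<in> sphere 0 1)"

definition spectral_value :: "(real \<Rightarrow> complex \<Rightarrow> complex) \<Rightarrow> complex \<Rightarrow> complex \<Rightarrow> bool" where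
  "spectral_value \<phi> \<tau> \<mu> \<longleftrightarrow> (\<forall>t\<ge>0. deriv (\<phi> t) \<tau> = exp (- \<mu> * of_real t))"

definition koenigs_function_non_elliptic ::
  "(real \<Rightarrow> complex \<Rightarrow> complex) \<Rightarrow> (complex \<Rightarrow> complex) \<Rightarrow> bool" where
  "koenigs_function_non_elliptic \<phi> h \<longleftrightarrow>
     h holomorphic_on unit_disc \<and> inj_on h unit_disc \<and>
     (\<forall>t\<ge>0. \<forall>z\<in>unit_disc. h (\<phi> t z) = h z + of_real t)"

definition koenigs_function_elliptic ::
  "(real \<Rightarrow> complex \<Rightarrow> complex) \<Rightarrow> complex \<Rightarrow> complex \<Rightarrow> (complex \<Rightarrow> complex) \<Rightarrow> bool" where
  "koenigs_function_elliptic \<phi> \<tau> \<mu> h \<longleftrightarrow>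
     h holomorphic_on unit_disc \<and> inj_on h unit_disc \<and> h \<tau> = 0 \<and>
     (\<forall>t\<ge>0. \<forall>z\<in>unit_disc. h (\<phi> t z) = exp (- \<mu> * of_real t) * h z)"

definition koenigs_domain :: "(complex \<Rightarrow> complex) \<Rightarrow> complex set" where
  "koenigs_domain h = h ` unit_disc"

text \<open>The number \<open>T\<^sub>z\<close>, possibly \<open>\<infinity>\<close>.\<close>

definition backward_time :: "(real \<Rightarrow> complex \<Rightarrow> complex) \<Rightarrow> complex \<Rightarrow> ereal" where
  "backward_time \<phi> z = Sup {ereal T |T. T > 0 \<and> (\<forall>t\<in>{0..<T}. z \<in> \<phi> t ` unit_disc)}"

definition backward_interval :: "(real \<Rightarrow> complex \<Rightarrow> complex) \<Rightarrow> complex \<Rightarrow> real set" where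
  "backward_interval \<phi> z = {t. 0 \<le> t \<and> ereal t < backward_time \<phi> z}"

definition backward_orbit :: "(real \<Rightarrow> complex \<Rightarrow> complex) \<Rightarrow> complex \<Rightarrow> real \<Rightarrow> complex" where
  "backward_orbit \<phi> z t = inv_into unit_disc (\<phi> t) z"

text \<open>The filter of real \<open>t\<close> tending to \<open>T \<in> (0, \<infinity>]\<close> from below.\<close>

definition real_at_left :: "ereal \<Rightarrow> real filter" where
  "real_at_left T = filtercomap ereal (at_left T)"

lemma filtercomap_ereal_filtermap: "filtercomap ereal (filtermap ereal F) = F"
  by (rule filter_eqI) (auto simp: eventually_filtercomap eventually_filtermap
      intro: exI[of _ "\<lambda>x. P (real_of_ereal x)" for P] elim: eventually_mono)

lemma real_at_left_ereal: "real_at_left (ereal T) = at_left T"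
  by (simp add: real_at_left_def at_left_ereal filtercomap_ereal_filtermap)

lemma real_at_left_infinity: "real_at_left \<infinity> = at_top"
  by (simp add: real_at_left_def at_left_PInf filtercomap_ereal_filtermap)

definition disc_density :: "complex \<Rightarrow> real" where
  "disc_density z = 1 / (1 - (norm z)\<^sup>2)"

definition disc_distance :: "complex \<Rightarrow> complex \<Rightarrow> real" where
  "disc_distance z w =
     1 / 2 * ln ((norm (1 - cnj z * w) + norm (z - w)) / (norm (1 - cnj z * w) - norm (z - w)))"

definition is_riemann_map :: "complex set \<Rightarrow> (complex \<Rightarrow> complex) \<Rightarrow> bool" where
  "is_riemann_map \<Omega> f \<longleftrightarrow> f holomorphic_on \<Omega> \<and> inj_on f \<Omega> \<and> f ` \<Omega> = unit_disc"

text \<open>The hyperbolic density and distance of a simply connected domain \<open>\<Omega> \<noteq> \<complex>\<close> do not depend on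
  the Riemann map, so any choice of it will do. On all other sets these two constants carry no
  meaning.\<close>

definition riemann_map :: "complex set \<Rightarrow> complex \<Rightarrow> complex" where
  "riemann_map \<Omega> = (SOME f. is_riemann_map \<Omega> f)"

definition hyperbolic_density :: "complex set \<Rightarrow> complex \<Rightarrow> real" where
  "hyperbolic_density \<Omega> z = disc_density (riemann_map \<Omega> z) * norm (deriv (riemann_map \<Omega>) z)"

definition hyperbolic_distance :: "complex set \<Rightarrow> complex \<Rightarrow> complex \<Rightarrow> real" where
  "hyperbolic_distance \<Omega> z w = disc_distance (riemann_map \<Omega> z) (riemann_map \<Omega> w)"

end

theory Submission
  imports Defs
begin

text \<open>
  If \<open>g\<close> is the inverse of \<open>h\<close>, then the backward orbit is \<open>\<gamma> t = g (p t)\<close> with \<open>p t = h z - t\<close> or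
  \<open>p t = exp (\<mu> t) h z\<close>. As \<open>g\<close> is a Riemann map of the Koenigs domain \<open>\<Omega>\<close>, the density of \<open>\<Omega>\<close> at
  \<open>p t\<close> is \<open>\<bar>g' (p t)\<bar> / (1 - \<bar>\<gamma> t\<bar>\<^sup>2)\<close>. On the other hand
  \<open>exp (2 k(z, w)) = (\<bar>1 - cnj z w\<bar> + \<bar>z - w\<bar>)\<^sup>2 / ((1 - \<bar>z\<bar>\<^sup>2) (1 - \<bar>w\<bar>\<^sup>2))\<close> in the disc, so for fixed \<open>z\<close>
  the factor \<open>1 - \<bar>\<gamma> t\<bar>\<^sup>2\<close> cancels from the quotient of the theorem, which is therefore comparable to
  \<open>\<bar>\<gamma>' t\<bar>\<close>. Since \<open>\<gamma>'\<close> is continuous, \<open>\<gamma>\<close> is Lipschitz iff \<open>\<gamma>'\<close> is bounded near the end point.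
\<close>

section \<open>Conformal invariance\<close>

lemma norm_one_minus_cnj_mult:
  "(norm (1 - cnj z * w))\<^sup>2 - (norm (z - w))\<^sup>2 = (1 - (norm z)\<^sup>2) * (1 - (norm w)\<^sup>2)"
  unfolding cmod_power2 by (simp add: algebra_simps power2_eq_square)

lemma norm_diff_less_norm_one_minus_cnj_mult:
  assumes "norm z < 1" "norm w < 1"
  shows "norm (z - w) < norm (1 - cnj z * w)"
proof -
  have "(norm z)\<^sup>2 < 1" "(norm w)\<^sup>2 < 1"
    using assms by (simp_all add: abs_square_less_1)
  then have "0 < (1 - (norm z)\<^sup>2) * (1 - (norm w)\<^sup>2)" by simp
  then have "(norm (z - w))\<^sup>2 < (norm (1 - cnj z * w))\<^sup>2"
    by (simp flip: norm_one_minus_cnj_mult)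
  then show ?thesis by (rule power2_less_imp_less) simp
qed

lemma norm_Moebius_function:
  "norm (Moebius_function 0 z w) = norm (z - w) / norm (1 - cnj z * w)"
  by (simp add: Moebius_function_def norm_divide norm_minus_commute)

text \<open>The modulus of \<open>Moebius_function 0 z w\<close> is the pseudo-hyperbolic distance
  of \<open>z\<close> and \<open>w\<close>. Disc automorphisms carrying 0 to \<open>z\<close> and
  \<open>f z\<close> to 0 reduce the claim to the Schwarz lemma for \<open>?F\<close>, which fixes
  0.\<close>

lemma Schwarz_Pick:
  assumes hol: "f holomorphic_on unit_disc" and im: "f ` unit_disc \<subseteq> unit_disc"
    and z: "norm z < 1" and w: "norm w < 1"
  shows "norm (Moebius_function 0 (f z) (f w)) \<le> norm (Moebius_function 0 z w)"
proof -
  let ?F = "\<lambda>u. Moebius_function 0 (f z) (f (Moebius_function 0 (- z) u))"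
  have M: "Moebius_function 0 (- z) ` unit_disc \<subseteq> unit_disc"
    using z by (auto intro!: Moebius_function_norm_lt_1)
  have fz: "norm (f x) < 1" if "norm x < 1" for x
    using im that by force
  have "f \<circ> Moebius_function 0 (- z) holomorphic_on unit_disc"
    using z M by (intro holomorphic_on_compose_gen[OF _ hol] Moebius_function_holomorphic) auto
  then have "Moebius_function 0 (f z) \<circ> (f \<circ> Moebius_function 0 (- z)) holomorphic_on unit_disc"
    using M im fz[OF z]
    by (intro holomorphic_on_compose_gen[OF _ Moebius_function_holomorphic]) auto
  then have 1: "?F holomorphic_on unit_disc" by (simp add: o_def)
  have 2: "?F 0 = 0" by (simp add: Moebius_function_of_zero Moebius_function_eq_zero)
  have 3: "norm (?F u) < 1" if "norm u < 1" for u
    using that z by (intro Moebius_function_norm_lt_1 fz) auto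
  \<comment> \<open>The evaluation point is the one that the inner Moebius map of \<open>?F\<close>
    sends back to \<open>w\<close>.\<close>
  have "norm (?F (Moebius_function 0 z w)) \<le> norm (Moebius_function 0 z w)"
    by (rule Schwarz_Lemma(1)[OF 1 2 3]) (use z w in \<open>auto intro!: Moebius_function_norm_lt_1\<close>)
  moreover have "Moebius_function 0 (- z) (Moebius_function 0 z w) = w"
    using z w by (intro Moebius_function_compose) auto
  ultimately show ?thesis by simp
qed

text \<open>Schwarz-Pick applies both to \<open>f\<close> and to its holomorphic inverse.\<close>

lemma norm_Moebius_function_automorphism:
  assumes hol: "f holomorphic_on unit_disc" and inj: "inj_on f unit_disc"
    and im: "f ` unit_disc = unit_disc" and z: "norm z < 1" and w: "norm w < 1"
  shows "norm (Moebius_function 0 (f z) (f w)) = norm (Moebius_function 0 z w)"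
proof (rule antisym)
  obtain g where g: "g holomorphic_on f ` unit_disc" "\<And>x. x \<in> unit_disc \<Longrightarrow> g (f x) = x"
    using holomorphic_has_inverse[OF hol open_ball inj] by metis
  have "g ` f ` unit_disc \<subseteq> unit_disc" using g(2) by auto
  then have gi: "g ` unit_disc \<subseteq> unit_disc" by (simp only: im)
  have fx: "norm (f x) < 1" if "norm x < 1" for x
    using im that by force
  show "norm (Moebius_function 0 z w) \<le> norm (Moebius_function 0 (f z) (f w))"
    using Schwarz_Pick[of g "f z" "f w"] g gi im fx z w by simp
  show "norm (Moebius_function 0 (f z) (f w)) \<le> norm (Moebius_function 0 z w)"
    using Schwarz_Pick[OF hol _ z w] im by simp
qed

text \<open>This is the infinitesimal form of the preceding invariance: divide the equality of
  pseudo-hyperbolic distances by \<open>norm (w - z)\<close> and let \<open>w\<close> tend to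
  \<open>z\<close>. Both sides converge, and limits are unique.\<close>

lemma disc_density_automorphism:
  assumes hol: "f holomorphic_on unit_disc" and inj: "inj_on f unit_disc"
    and im: "f ` unit_disc = unit_disc" and z: "norm z < 1"
  shows "disc_density (f z) * norm (deriv f z) = disc_density z"
proof -
  have fx: "norm (f x) < 1" if "norm x < 1" for x
    using im that by force
  \<comment> \<open>On the diagonal the denominator of the Moebius map becomes the reciprocal of
    \<open>disc_density\<close>.\<close>
  have sq: "norm (1 - cnj x * x) = 1 - (norm x)\<^sup>2" if "norm x < 1" for x
  proof -
    have "1 - cnj x * x = of_real (1 - (norm x)\<^sup>2)"
      using complex_norm_square[of x] by (simp add: mult.commute)
    moreover have "(norm x)\<^sup>2 < 1" using that by (simp add: abs_square_less_1)
    ultimately show ?thesis by (metis abs_of_pos diff_gt_0_iff_gt norm_of_real)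
  qed
  have "(f has_field_derivative deriv f z) (at z)"
    using hol z by (intro holomorphic_derivI[of f unit_disc]) auto
  then have "((\<lambda>w. (f w - f z) / (w - z)) \<longlongrightarrow> deriv f z) (at z)"
    by (simp add: has_field_derivative_iff)
  moreover have "isCont f z"
    using \<open>(f has_field_derivative deriv f z) (at z)\<close> by (rule DERIV_isCont)
  moreover have nz: "1 - cnj (f z) * f z \<noteq> 0" "1 - cnj z * z \<noteq> 0"
    using norm_diff_less_norm_one_minus_cnj_mult[of z z] fx[OF z] z
      norm_diff_less_norm_one_minus_cnj_mult[of "f z" "f z"] by auto
  ultimately have 1: "((\<lambda>w. norm ((f w - f z) / (w - z)) / norm (1 - cnj (f z) * f w))
      \<longlongrightarrow> norm (deriv f z) / norm (1 - cnj (f z) * f z)) (at z)"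
    by (intro tendsto_intros) (auto simp: isCont_def)
  have 2: "((\<lambda>w. 1 / norm (1 - cnj z * w)) \<longlongrightarrow> 1 / norm (1 - cnj z * z)) (at z)"
    using nz by (intro tendsto_intros) auto
  have "eventually (\<lambda>w. w \<in> unit_disc - {z}) (at z)"
    using z by (intro eventually_at_in_open) auto
  then have "eventually (\<lambda>w. norm ((f w - f z) / (w - z)) / norm (1 - cnj (f z) * f w)
      = 1 / norm (1 - cnj z * w)) (at z)"
  proof eventually_elim
    case (elim w)
    then have w: "norm w < 1" "w \<noteq> z" by auto
    have "norm (f z - f w) / norm (1 - cnj (f z) * f w) = norm (z - w) / norm (1 - cnj z * w)"
      using norm_Moebius_function_automorphism[OF hol inj im z w(1)]
      by (simp add: norm_Moebius_function)
    then have "norm (f w - f z) / norm (1 - cnj (f z) * f w) / norm (w - z)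
        = norm (w - z) / norm (1 - cnj z * w) / norm (w - z)"
      by (simp add: norm_minus_commute)
    then show ?case using w(2) by (simp add: norm_divide mult.commute)
  qed
  with 1 have "((\<lambda>w. 1 / norm (1 - cnj z * w)) \<longlongrightarrow>
      norm (deriv f z) / norm (1 - cnj (f z) * f z)) (at z)"
    by (rule Lim_transform_eventually)
  then have "norm (deriv f z) / norm (1 - cnj (f z) * f z) = 1 / norm (1 - cnj z * z)"
    using 2 by (intro tendsto_unique[OF trivial_limit_at])
  then show ?thesis
    using sq[OF z] sq[OF fx[OF z]] by (simp add: disc_density_def)
qed

section \<open>Hyperbolic density and distance of the Koenigs domain, pulled back to the
  disc\<close>

lemma disc_distance_Moebius_function:
  assumes "norm z < 1" "norm w < 1"
  shows "disc_distance z w = 1 / 2 * ln ((1 + norm (Moebius_function 0 z w))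
    / (1 - norm (Moebius_function 0 z w)))"
proof -
  have "norm (z - w) < norm (1 - cnj z * w)"
    using assms by (rule norm_diff_less_norm_one_minus_cnj_mult)
  then have pos: "norm (1 - cnj z * w) > 0"
    using norm_ge_zero[of "z - w"] by linarith
  then have "1 + norm (Moebius_function 0 z w)
      = (norm (1 - cnj z * w) + norm (z - w)) / norm (1 - cnj z * w)"
    "1 - norm (Moebius_function 0 z w)
      = (norm (1 - cnj z * w) - norm (z - w)) / norm (1 - cnj z * w)"
    by (simp_all add: norm_Moebius_function add_divide_distrib diff_divide_distrib)
  then show ?thesis using pos by (simp add: disc_distance_def)
qed

text \<open>For any Riemann map \<open>f\<close> of the Koenigs domain, the composition of
  \<open>f\<close> with \<open>h\<close> is an automorphism of the disc, so both claims reduce to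
  invariance under automorphisms; the factor \<open>norm (deriv h z)\<close> comes from the chain
  rule.\<close>

lemma
  assumes hol: "h holomorphic_on unit_disc" and inj: "inj_on h unit_disc"
    and z: "norm z < 1" and w: "norm w < 1"
  shows hyperbolic_density_koenigs:
      "hyperbolic_density (koenigs_domain h) (h z) * norm (deriv h z) = disc_density z"
    and hyperbolic_distance_koenigs:
      "hyperbolic_distance (koenigs_domain h) (h z) (h w) = disc_distance z w"
proof -
  let ?\<Omega> = "koenigs_domain h"
  define f where "f = riemann_map ?\<Omega>"
  obtain g where g: "g holomorphic_on h ` unit_disc" "\<And>x. x \<in> unit_disc \<Longrightarrow> g (h x) = x"
    using holomorphic_has_inverse[OF hol open_ball inj] by metis
  \<comment> \<open>The inverse of \<open>h\<close> witnesses that a Riemann map exists, so the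
    choice made in \<open>riemann_map\<close> really is one.\<close>
  have "is_riemann_map ?\<Omega> g"
    using g by (auto simp: is_riemann_map_def koenigs_domain_def inj_on_def image_image)
  then have "is_riemann_map ?\<Omega> f"
    unfolding f_def riemann_map_def by (metis someI)
  then have f: "f holomorphic_on h ` unit_disc" "inj_on f (h ` unit_disc)"
      "f ` h ` unit_disc = unit_disc"
    by (auto simp: is_riemann_map_def koenigs_domain_def)
  have opn: "open (h ` unit_disc)" by (rule open_mapping_thm3[OF hol _ inj]) simp
  have hol': "f \<circ> h holomorphic_on unit_disc"
    by (rule holomorphic_on_compose[OF hol f(1)])
  have inj': "inj_on (f \<circ> h) unit_disc"
    by (rule comp_inj_on[OF inj f(2)])
  have im': "(f \<circ> h) ` unit_disc = unit_disc" using f(3) by (simp add: image_comp)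
  have "deriv (f \<circ> h) z = deriv f (h z) * deriv h z"
  proof (rule deriv_chain)
    show "h field_differentiable at z"
      using hol z by (auto intro: holomorphic_on_imp_differentiable_at)
    show "f field_differentiable at (h z)"
      using f(1) opn z by (auto intro: holomorphic_on_imp_differentiable_at)
  qed
  then show "hyperbolic_density ?\<Omega> (h z) * norm (deriv h z) = disc_density z"
    using disc_density_automorphism[OF hol' inj' im' z]
    by (simp add: hyperbolic_density_def f_def norm_mult mult.assoc)
  have "norm (f (h z)) < 1" "norm (f (h w)) < 1"
    using im' z w by auto
  then have "disc_distance (f (h z)) (f (h w)) = disc_distance z w"
    using norm_Moebius_function_automorphism[OF hol' inj' im' z w] z w
    by (simp add: disc_distance_Moebius_function)
  then show "hyperbolic_distance ?\<Omega> (h z) (h w) = disc_distance z w"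
    by (simp add: hyperbolic_distance_def f_def)
qed

section \<open>The quotient of the theorem, computed and bounded in the disc\<close>

lemma disc_density_div_exp_disc_distance:
  assumes "norm z < 1" "norm w < 1"
  shows "disc_density w / exp (2 * disc_distance z w)
    = (1 - (norm z)\<^sup>2) / (norm (1 - cnj z * w) + norm (z - w))\<^sup>2"
proof -
  define a b where "a = norm (1 - cnj z * w)" and "b = norm (z - w)"
  have ab: "0 \<le> b" "b < a"
    using norm_diff_less_norm_one_minus_cnj_mult[OF assms] by (auto simp: a_def b_def)
  have w: "1 - (norm w)\<^sup>2 > 0" using assms by (simp add: abs_square_less_1)
  have e: "exp (2 * disc_distance z w) = (a + b) / (a - b)"
    using ab by (simp add: disc_distance_def flip: a_def b_def)
  have "(a + b) * (a - b) = (1 - (norm z)\<^sup>2) * (1 - (norm w)\<^sup>2)"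
    using norm_one_minus_cnj_mult[of z w] by (simp add: a_def b_def power2_eq_square algebra_simps)
  then have "1 - (norm z)\<^sup>2 = (a + b) * (a - b) / (1 - (norm w)\<^sup>2)"
    using w by (metis less_irrefl nonzero_mult_div_cancel_right)
  \<comment> \<open>Expanding by \<open>a + b\<close> produces the product
    \<open>(a + b) * (a - b)\<close>, whose factor \<open>1 - (norm w)\<^sup>2\<close> then cancels
    against \<open>W\<close>.\<close>
  moreover have "1 / W / ((a + b) / (a - b)) = (a + b) * (a - b) / W / (a + b)\<^sup>2" for W
    using ab by (simp add: power2_eq_square)
  ultimately show ?thesis
    unfolding e disc_density_def a_def[symmetric] b_def[symmetric] by simp
qed

text \<open>By the preceding formula only the sum \<open>?s\<close> depends on \<open>w\<close>. It
  lies between \<open>1 - norm z\<close> and 4, which yields constants depending on \<open>z\<close>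
  alone.\<close>

lemma disc_density_div_exp_disc_distance_bounds:
  assumes z: "norm z < 1"
  obtains c d where "c > 0" "d > 0"
    "\<And>w. norm w < 1 \<Longrightarrow> c \<le> disc_density w / exp (2 * disc_distance z w)"
    "\<And>w. norm w < 1 \<Longrightarrow> disc_density w / exp (2 * disc_distance z w) \<le> d"
proof (rule that)
  have z2: "1 - (norm z)\<^sup>2 > 0" using z by (simp add: abs_square_less_1)
  show "(1 - (norm z)\<^sup>2) / 4\<^sup>2 > 0" "(1 - (norm z)\<^sup>2) / (1 - norm z)\<^sup>2 > 0"
    using z z2 by simp_all
  fix w :: complex assume w: "norm w < 1"
  let ?s = "norm (1 - cnj z * w) + norm (z - w)"
  have zw: "norm (cnj z * w) \<le> norm z"
    using w by (simp add: norm_mult mult_left_le)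
  have "norm (1 - cnj z * w) \<le> 1 + norm (cnj z * w)" "norm (z - w) \<le> norm z + norm w"
    using norm_triangle_ineq4[of 1 "cnj z * w"] norm_triangle_ineq4[of z w] by simp_all
  then have s4: "?s \<le> 4" using zw z w by linarith
  have "1 - norm (cnj z * w) \<le> norm (1 - cnj z * w)"
    using norm_triangle_ineq2[of 1 "cnj z * w"] by simp
  then have s1: "1 - norm z \<le> ?s" using zw norm_ge_zero[of "z - w"] by linarith
  then have "(1 - norm z)\<^sup>2 \<le> ?s\<^sup>2"
    using z by (intro power_mono) auto
  moreover have "?s\<^sup>2 \<le> 4\<^sup>2" using s4 by (rule power_mono) simp
  moreover have "0 < (1 - norm z)\<^sup>2" using z by simp
  ultimately have "(1 - (norm z)\<^sup>2) / 4\<^sup>2 \<le> (1 - (norm z)\<^sup>2) / ?s\<^sup>2"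
    "(1 - (norm z)\<^sup>2) / ?s\<^sup>2 \<le> (1 - (norm z)\<^sup>2) / (1 - norm z)\<^sup>2"
    using z2 by (meson divide_left_mono less_imp_le less_le_trans mult_pos_pos)+
  then show "(1 - (norm z)\<^sup>2) / 4\<^sup>2 \<le> disc_density w / exp (2 * disc_distance z w)"
    "disc_density w / exp (2 * disc_distance z w) \<le> (1 - (norm z)\<^sup>2) / (1 - norm z)\<^sup>2"
    unfolding disc_density_div_exp_disc_distance[OF z w] by blast+
qed

section \<open>Lipschitz paths and bounded derivatives\<close>

text \<open>This treats finite and infinite \<open>T\<close> uniformly. Since \<open>T > 0\<close>,
  the bound \<open>b\<close> can be raised to be nonnegative, so the final segment lies in the
  interval from 0 to \<open>T\<close>.\<close>

lemma eventually_real_at_left: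
  assumes "T > 0"
  shows "eventually P (real_at_left T) \<longleftrightarrow> (\<exists>b\<ge>0. ereal b < T \<and> (\<forall>t>b. ereal t < T \<longrightarrow> P t))"
proof (cases T)
  case (real r)
  then have r: "r > 0" using assms by simp
  have "eventually P (at_left r) \<longleftrightarrow> (\<exists>b<r. \<forall>t>b. t < r \<longrightarrow> P t)"
    by (rule eventually_at_left[OF r])
  also have "\<dots> \<longleftrightarrow> (\<exists>b\<ge>0. b < r \<and> (\<forall>t>b. t < r \<longrightarrow> P t))"
  proof
    assume "\<exists>b<r. \<forall>t>b. t < r \<longrightarrow> P t"
    then obtain b where "b < r" "\<forall>t>b. t < r \<longrightarrow> P t" by blast
    then show "\<exists>b\<ge>0. b < r \<and> (\<forall>t>b. t < r \<longrightarrow> P t)"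
      using r by (intro exI[of _ "max b 0"]) auto
  qed auto
  finally show ?thesis using real by (simp add: real_at_left_ereal)
next
  case PInf
  have "eventually P at_top \<longleftrightarrow> (\<exists>b\<ge>0. \<forall>t>b. P t)"
  proof
    assume "eventually P at_top"
    then obtain b where "\<forall>t>b. P t" by (auto simp: eventually_at_top_dense)
    then show "\<exists>b\<ge>0. \<forall>t>b. P t" by (intro exI[of _ "max b 0"]) auto
  qed (auto simp: eventually_at_top_dense)
  then show ?thesis using PInf by (simp add: real_at_left_infinity)
qed (use assms in auto)

text \<open>A Lipschitz constant bounds all difference quotients and hence the derivative.
  Conversely, a bound near \<open>T\<close> extends to all of \<open>I\<close> by continuity of
  \<open>G'\<close> on a compact initial segment, and the mean value inequality applies.\<close>

lemma lipschitz_iff_derivative_eventually_bounded: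
  fixes G G' :: "real \<Rightarrow> 'a::real_normed_vector"
  assumes T: "T > 0" and I: "I = {t. 0 \<le> t \<and> ereal t < T}"
    and der: "\<And>t. t \<in> I \<Longrightarrow> (G has_vector_derivative G' t) (at t within I)"
    and cont: "continuous_on I G'"
  shows "(\<exists>C>0. C-lipschitz_on I G) \<longleftrightarrow>
    (\<exists>B. eventually (\<lambda>t. norm (G' t) \<le> B) (real_at_left T))"
proof -
  have le_T: "ereal x < T" if "x \<le> y" "ereal y < T" for x y
    using that by (metis ereal_less_eq(3) le_less_trans)
  show ?thesis
  proof
    assume "\<exists>C>0. C-lipschitz_on I G"
    then obtain C where C: "C-lipschitz_on I G" by blast
    have "norm (G' t) \<le> C" if "t \<in> I" for t
    proof -
      \<comment> \<open>Difference quotients are taken to the right of \<open>t\<close>, which also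
        works at the left end point 0.\<close>
      obtain s where s: "t < s" "ereal s < T"
        using \<open>t \<in> I\<close> ereal_dense2[of "ereal t" T] by (auto simp: I)
      have sub: "{t..s} \<subseteq> I" using that s(2) le_T by (auto simp: I)
      \<comment> \<open>The relative error of the linear approximation at \<open>t\<close>; it tends
        to 0 by differentiability.\<close>
      define r where "r = (\<lambda>y. norm (G y - G t - (y - t) *\<^sub>R G' t) / norm (y - t))"
      have "(G has_vector_derivative G' t) (at t within {t..s})"
        by (rule has_vector_derivative_within_subset[OF der[OF that] sub])
      then have "(r \<longlongrightarrow> 0) (at t within {t..s})"
        by (simp add: has_vector_derivative_def has_derivative_iff_norm r_def)
      then have "((\<lambda>y. C + r y) \<longlongrightarrow> C + 0) (at t within {t..s})"
        by (intro tendsto_intros)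
      moreover have "eventually (\<lambda>y. norm (G' t) \<le> C + r y) (at t within {t..s})"
        unfolding eventually_at_filter
      proof (intro always_eventually allI impI)
        fix y assume y: "y \<noteq> t" "y \<in> {t..s}"
        have "norm ((y - t) *\<^sub>R G' t) \<le> norm (G y - G t) + norm (G y - G t - (y - t) *\<^sub>R G' t)"
          using norm_triangle_ineq4[of "G y - G t" "G y - G t - (y - t) *\<^sub>R G' t"] by simp
        also have "norm (G y - G t) \<le> C * norm (y - t)"
          using lipschitz_onD[OF C, of y t] y sub that by (auto simp: dist_norm)
        finally have "\<bar>y - t\<bar> * norm (G' t)
            \<le> C * \<bar>y - t\<bar> + norm (G y - G t - (y - t) *\<^sub>R G' t)"
          by simp
        also have "\<dots> = \<bar>y - t\<bar> * (C + r y)"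
          using y by (simp add: r_def distrib_left)
        finally show "norm (G' t) \<le> C + r y"
          using y by simp
      qed
      moreover have "at t within {t..s} \<noteq> bot"
        using s by (simp add: at_within_Icc_at_right trivial_limit_at_right_real)
      ultimately have "norm (G' t) \<le> C + 0" by (rule tendsto_lowerbound)
      then show ?thesis by simp
    qed
    then have "\<forall>t>0. ereal t < T \<longrightarrow> norm (G' t) \<le> C" by (auto simp: I)
    moreover have "ereal 0 < T" using T by (simp add: zero_ereal_def)
    ultimately show "\<exists>B. eventually (\<lambda>t. norm (G' t) \<le> B) (real_at_left T)"
      unfolding eventually_real_at_left[OF T] by blast
  next
    assume "\<exists>B. eventually (\<lambda>t. norm (G' t) \<le> B) (real_at_left T)"
    then obtain B b where b: "b \<ge> 0" "ereal b < T" "\<And>t. t > b \<Longrightarrow> ereal t < T \<Longrightarrow> norm (G' t) \<le> B"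
      unfolding eventually_real_at_left[OF T] by blast
    have sub: "{0..b} \<subseteq> I" using b(2) le_T by (auto simp: I)
    have "compact (G' ` {0..b})"
      by (intro compact_continuous_image continuous_on_subset[OF cont sub]) simp
    then obtain A where A: "\<And>t. t \<in> {0..b} \<Longrightarrow> norm (G' t) \<le> A"
      by (meson bounded_iff compact_imp_bounded imageI)
    \<comment> \<open>\<open>A\<close> controls the derivative up to \<open>b\<close> and
      \<open>B\<close> beyond it; the 1 makes the constant positive.\<close>
    define C where "C = max 1 (max A B)"
    have bd: "norm (G' t) \<le> C" if "t \<in> I" for t
      using A[of t] b(3)[of t] that by (cases "t \<le> b") (auto simp: C_def I)
    have "convex I"
      unfolding I is_interval_convex_1[symmetric] is_interval_1 by (auto intro: le_T)
    then have "C-lipschitz_on I G"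
    proof (rule bounded_derivative_imp_lipschitz[rotated])
      fix t assume "t \<in> I"
      then show "(G has_derivative (\<lambda>x. x *\<^sub>R G' t)) (at t within I)"
        using der by (simp add: has_vector_derivative_def)
      show "onorm (\<lambda>x. x *\<^sub>R G' t) \<le> C"
        using bd[OF \<open>t \<in> I\<close>] by (intro onorm_le) (simp add: mult.commute[of C] mult_left_mono)
    qed (auto simp: C_def)
    then show "\<exists>C>0. C-lipschitz_on I G" by (intro exI[of _ C]) (auto simp: C_def)
  qed
qed

text \<open>A limit superior below infinity lies strictly below some real number, which is then an
  eventual bound.\<close>

lemma Limsup_ereal_less_infinity_iff:
  "Limsup F (\<lambda>x. ereal (f x)) < \<infinity> \<longleftrightarrow> (\<exists>B. eventually (\<lambda>x. f x \<le> B) F)"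
proof
  assume "Limsup F (\<lambda>x. ereal (f x)) < \<infinity>"
  then obtain B where "Limsup F (\<lambda>x. ereal (f x)) < ereal B"
    by (metis ereal_dense2)
  then have "eventually (\<lambda>x. ereal (f x) < ereal B) F"
    by (rule Limsup_lessD)
  then show "\<exists>B. eventually (\<lambda>x. f x \<le> B) F"
    by (intro exI[of _ B]) (auto elim: eventually_mono)
next
  assume "\<exists>B. eventually (\<lambda>x. f x \<le> B) F"
  then obtain B where "eventually (\<lambda>x. ereal (f x) \<le> ereal B) F" by auto
  then have "Limsup F (\<lambda>x. ereal (f x)) \<le> ereal B" by (rule Limsup_bounded)
  then show "Limsup F (\<lambda>x. ereal (f x)) < \<infinity>" using le_less_trans by fastforce
qed

section \<open>Backward orbits\<close>

text \<open>Both cases of the theorem at once: \<open>p\<close> is the backward orbit of \<open>h z\<close> under the flow that \<open>h\<close>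
  conjugates to \<open>\<phi>\<close>.\<close>

lemma backward_orbit_lipschitz_iff:
  assumes im: "\<And>t. t \<ge> 0 \<Longrightarrow> \<phi> t ` unit_disc \<subseteq> unit_disc"
    and hol: "h holomorphic_on unit_disc" and inj: "inj_on h unit_disc"
    and z: "z \<in> unit_disc"
    and conj: "\<And>t w. t \<ge> 0 \<Longrightarrow> w \<in> unit_disc \<Longrightarrow> h (\<phi> t w) = h z \<longleftrightarrow> h w = p t"
    and p0: "p 0 = h z"
    and der: "\<And>t. (p has_vector_derivative p' t) (at t)"
    and cont: "continuous_on UNIV p'"
    and K: "K > 0" and k: "\<And>t. norm (p' t) = K * k t"
  shows "(\<exists>C>0. C-lipschitz_on (backward_interval \<phi> z) (backward_orbit \<phi> z)) \<longleftrightarrow>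
    Limsup (real_at_left (backward_time \<phi> z))
      (\<lambda>t. ereal (k t * hyperbolic_density (koenigs_domain h) (p t) /
        exp (2 * hyperbolic_distance (koenigs_domain h) (h z) (p t)))) < \<infinity>"
proof -
  define \<Omega> I T where "\<Omega> = h ` unit_disc" and "I = backward_interval \<phi> z"
    and "T = backward_time \<phi> z"
  obtain g where g: "g holomorphic_on \<Omega>" "\<And>x. x \<in> unit_disc \<Longrightarrow> deriv h x * deriv g (h x) = 1"
      "\<And>x. x \<in> unit_disc \<Longrightarrow> g (h x) = x"
    using holomorphic_has_inverse[OF hol open_ball inj] unfolding \<Omega>_def by metis
  have opn: "open \<Omega>" unfolding \<Omega>_def by (rule open_mapping_thm3[OF hol _ inj]) simp
  \<comment> \<open>The backward orbit exists at time \<open>t\<close> exactly when the path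
    \<open>p\<close> is in the Koenigs domain; the converse direction recovers \<open>z\<close> from
    \<open>h z\<close> by injectivity.\<close>
  have range_iff: "z \<in> \<phi> t ` unit_disc \<longleftrightarrow> p t \<in> \<Omega>" if "t \<ge> 0" for t
  proof
    assume "z \<in> \<phi> t ` unit_disc"
    then show "p t \<in> \<Omega>" using conj[OF that] unfolding \<Omega>_def by force
  next
    assume "p t \<in> \<Omega>"
    then obtain w where w: "w \<in> unit_disc" "h w = p t" unfolding \<Omega>_def by force
    then have "h (\<phi> t w) = h z" using conj[OF that] by blast
    moreover have "\<phi> t w \<in> unit_disc" using im[OF that] w(1) by blast
    ultimately have "\<phi> t w = z" using z by (rule inj_onD[OF inj])
    then show "z \<in> \<phi> t ` unit_disc" using w(1) by blast
  qed
  have contp: "continuous_on UNIV p"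
    using der by (intro continuous_at_imp_continuous_on ballI has_vector_derivative_continuous)
  \<comment> \<open>The path starts in the open set \<open>\<Omega>\<close> and stays there for a
    short time, so \<open>T\<close> is positive.\<close>
  have "open (p -` \<Omega>)" by (rule open_vimage[OF opn contp])
  moreover have "0 \<in> p -` \<Omega>" using p0 z by (simp add: \<Omega>_def)
  ultimately obtain e where e: "e > 0" "ball 0 e \<subseteq> p -` \<Omega>"
    using open_contains_ball by blast
  have "z \<in> \<phi> t ` unit_disc" if "t \<in> {0..<e}" for t
  proof -
    have "t \<in> ball 0 e" using that by simp
    then have "p t \<in> \<Omega>" using e(2) by blast
    then show ?thesis using range_iff[of t] that by simp
  qed
  then have "ereal e \<le> T"
    unfolding T_def backward_time_def using e(1) by (intro Sup_upper) blast
  then have T: "T > 0" using e(1) by (metis ereal_less(2) less_le_trans)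
  have I: "I = {t. 0 \<le> t \<and> ereal t < T}"
    by (simp add: I_def backward_interval_def T_def)
  have inI: "p t \<in> \<Omega>" "z \<in> \<phi> t ` unit_disc" "t \<ge> 0" if "t \<in> I" for t
  proof -
    show t: "t \<ge> 0" using that I by auto
    have "ereal t < T" using that I by auto
    \<comment> \<open>A time below the supremum is below some admissible \<open>S\<close>, and
      admissibility covers all earlier times.\<close>
    then obtain S where "t < S" "\<forall>t\<in>{0..<S}. z \<in> \<phi> t ` unit_disc"
      unfolding T_def backward_time_def less_Sup_iff by auto
    then show "z \<in> \<phi> t ` unit_disc" using t by auto
    then show "p t \<in> \<Omega>" using range_iff t by auto
  qed
  have orbit: "backward_orbit \<phi> z t \<in> unit_disc" "h (backward_orbit \<phi> z t) = p t"
    if "t \<in> I" for t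
  proof -
    show 1: "backward_orbit \<phi> z t \<in> unit_disc"
      unfolding backward_orbit_def by (rule inv_into_into[OF inI(2)[OF that]])
    have "\<phi> t (backward_orbit \<phi> z t) = z"
      unfolding backward_orbit_def by (rule f_inv_into_f[OF inI(2)[OF that]])
    then show "h (backward_orbit \<phi> z t) = p t" using conj[OF inI(3)[OF that] 1] by simp
  qed
  have orbit_eq: "backward_orbit \<phi> z t = g (p t)" if "t \<in> I" for t
    using g(3) orbit[OF that] by metis
  \<comment> \<open>The velocity of the backward orbit, by the chain rule for \<open>g\<close> along
    \<open>p\<close>.\<close>
  define G' where "G' = (\<lambda>t. p' t * deriv g (p t))"
  have derG: "(backward_orbit \<phi> z has_vector_derivative G' t) (at t within I)" if "t \<in> I" for t
  proof -
    have "(g has_field_derivative deriv g (p t)) (at (p t))"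
      using g(1) opn inI(1)[OF that] by (rule holomorphic_derivI)
    then have "((g \<circ> p) has_vector_derivative G' t) (at t within I)"
      unfolding G'_def
      by (rule has_vector_derivative_at_within[OF field_vector_diff_chain_at[OF der]])
    then show ?thesis
      by (rule has_vector_derivative_transform[OF that, rotated]) (simp add: orbit_eq)
  qed
  have "continuous_on \<Omega> (deriv g)"
    using g(1) opn by (intro holomorphic_on_imp_continuous_on holomorphic_deriv)
  then have "continuous_on I (\<lambda>t. deriv g (p t))"
    by (rule continuous_on_compose2[OF _ continuous_on_subset[OF contp]]) (use inI(1) in auto)
  then have contG: "continuous_on I G'"
    unfolding G'_def by (rule continuous_on_mult[OF continuous_on_subset[OF cont subset_UNIV]])
  obtain c d where cd: "c > 0" "d > 0"
    "\<And>w. norm w < 1 \<Longrightarrow> c \<le> disc_density w / exp (2 * disc_distance z w)"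
    "\<And>w. norm w < 1 \<Longrightarrow> disc_density w / exp (2 * disc_distance z w) \<le> d"
    using disc_density_div_exp_disc_distance_bounds[of z] z unfolding mem_ball_0 by metis
  define Q where "Q = (\<lambda>t. k t * hyperbolic_density (koenigs_domain h) (p t) /
        exp (2 * hyperbolic_distance (koenigs_domain h) (h z) (p t)))"
  \<comment> \<open>The density at \<open>p t\<close> is
    \<open>disc_density w * norm (deriv g (p t))\<close>, and \<open>K * k t\<close> is the speed of
    \<open>p\<close>. Thus \<open>K * Q t\<close> is \<open>norm (G' t)\<close> times the disc
    quotient, which lies between \<open>c\<close> and \<open>d\<close>.\<close>
  have Q: "c * norm (G' t) \<le> K * Q t" "K * Q t \<le> d * norm (G' t)" if "t \<in> I" for t
  proof -
    define w where "w = backward_orbit \<phi> z t"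
    have w: "norm w < 1" "h w = p t" using orbit[OF that] by (auto simp: w_def)
    have "deriv h w * deriv g (p t) = 1" using g(2)[of w] w by simp
    then have "norm (deriv h w) * norm (deriv g (p t)) = 1"
      by (metis norm_mult norm_one)
    then have "hyperbolic_density (koenigs_domain h) (p t) = disc_density w * norm (deriv g (p t))"
      using hyperbolic_density_koenigs[OF hol inj w(1) w(1)] w(2)
      by (metis mult.assoc mult.right_neutral)
    moreover have "hyperbolic_distance (koenigs_domain h) (h z) (p t) = disc_distance z w"
      using hyperbolic_distance_koenigs[OF hol inj _ w(1), of z] z w(2) by simp
    ultimately have "K * Q t = disc_density w / exp (2 * disc_distance z w) * norm (G' t)"
      by (simp add: Q_def G'_def norm_mult k)
    then show "c * norm (G' t) \<le> K * Q t" "K * Q t \<le> d * norm (G' t)"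
      using cd(3,4)[OF w(1)] by (simp_all only: mult_right_mono norm_ge_zero)
  qed
  have evI: "eventually (\<lambda>t. t \<in> I) (real_at_left T)"
    unfolding eventually_real_at_left[OF T] using T by (intro exI[of _ 0]) (auto simp: I zero_ereal_def)
  have "(\<exists>B. eventually (\<lambda>t. norm (G' t) \<le> B) (real_at_left T)) \<longleftrightarrow>
      (\<exists>B. eventually (\<lambda>t. Q t \<le> B) (real_at_left T))" (is "?l \<longleftrightarrow> ?r")
  proof
    assume ?l
    then obtain B where "eventually (\<lambda>t. norm (G' t) \<le> B) (real_at_left T)" by blast
    with evI have "eventually (\<lambda>t. Q t \<le> d * B / K) (real_at_left T)"
    proof eventually_elim
      case (elim t)
      then have "K * Q t \<le> d * B"
        using Q(2)[of t] cd(2) by (meson mult_left_mono less_imp_le order_trans)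
      then show ?case using K by (simp add: field_simps)
    qed
    then show ?r by blast
  next
    assume ?r
    then obtain B where "eventually (\<lambda>t. Q t \<le> B) (real_at_left T)" by blast
    with evI have "eventually (\<lambda>t. norm (G' t) \<le> K * B / c) (real_at_left T)"
    proof eventually_elim
      case (elim t)
      then have "c * norm (G' t) \<le> K * B"
        using Q(1)[of t] K by (meson mult_left_mono less_imp_le order_trans)
      then show ?case using cd(1) by (simp add: field_simps)
    qed
    then show ?l by blast
  qed
  then show ?thesis
    using lipschitz_iff_derivative_eventually_bounded[OF T I derG contG]
    unfolding Limsup_ereal_less_infinity_iff by (simp add: Q_def I_def T_def)
qed

theorem theorem1p3:
  fixes \<phi> :: "real \<Rightarrow> complex \<Rightarrow> complex" and h :: "complex \<Rightarrow> complex"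
    and \<Omega> :: "complex set" and z :: complex
  assumes "holomorphic_semigroup \<phi>"
    and "\<Omega> = koenigs_domain h"
    and "z \<in> unit_disc"
  shows "(non_elliptic \<phi> \<and> koenigs_function_non_elliptic \<phi> h \<longrightarrow>
      ((\<exists>C>0. C-lipschitz_on (backward_interval \<phi> z) (backward_orbit \<phi> z)) \<longleftrightarrow>
       Limsup (real_at_left (backward_time \<phi> z))
         (\<lambda>t. ereal (hyperbolic_density \<Omega> (h z - of_real t) /
                exp (2 * hyperbolic_distance \<Omega> (h z) (h z - of_real t)))) < \<infinity>)) \<and>
    (\<forall>\<tau> \<mu>. denjoy_wolff_point \<phi> \<tau> \<and> \<tau> \<in> unit_disc \<and> spectral_value \<phi> \<tau> \<mu> \<and> Re \<mu> > 0 \<and>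
        koenigs_function_elliptic \<phi> \<tau> \<mu> h \<and> z \<noteq> \<tau> \<longrightarrow>
      ((\<exists>C>0. C-lipschitz_on (backward_interval \<phi> z) (backward_orbit \<phi> z)) \<longleftrightarrow>
       Limsup (real_at_left (backward_time \<phi> z))
         (\<lambda>t. ereal (exp (Re \<mu> * t) * hyperbolic_density \<Omega> (exp (\<mu> * of_real t) * h z) /
                exp (2 * hyperbolic_distance \<Omega> (h z) (exp (\<mu> * of_real t) * h z)))) < \<infinity>))"
proof (intro conjI allI impI)
  have im: "\<phi> t ` unit_disc \<subseteq> unit_disc" if "t \<ge> 0" for t
    using assms(1) that by (simp add: holomorphic_semigroup_def)
  {
    assume "non_elliptic \<phi> \<and> koenigs_function_non_elliptic \<phi> h"
    then have h: "h holomorphic_on unit_disc" "inj_on h unit_disc"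
        "\<And>t w. t \<ge> 0 \<Longrightarrow> w \<in> unit_disc \<Longrightarrow> h (\<phi> t w) = h w + of_real t"
      by (auto simp: koenigs_function_non_elliptic_def)
    have "((\<lambda>t. h z - of_real t) has_vector_derivative - 1) (at t)" for t :: real
      by (auto intro!: derivative_eq_intros)
    then show "(\<exists>C>0. C-lipschitz_on (backward_interval \<phi> z) (backward_orbit \<phi> z)) \<longleftrightarrow>
       Limsup (real_at_left (backward_time \<phi> z))
         (\<lambda>t. ereal (hyperbolic_density \<Omega> (h z - of_real t) /
                exp (2 * hyperbolic_distance \<Omega> (h z) (h z - of_real t)))) < \<infinity>"
      unfolding assms(2)
      \<comment> \<open>The path is a horizontal line traversed with unit speed, hence
        \<open>K\<close> and \<open>k\<close> are 1.\<close>
      using backward_orbit_lipschitz_iff[OF im h(1,2) assms(3), where p = "\<lambda>t. h z - of_real t"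
          and p' = "\<lambda>_. - 1" and K = 1 and k = "\<lambda>_. 1"] h(3)
      by (simp add: eq_diff_eq)
  next
    fix \<tau> \<mu>
    assume *: "denjoy_wolff_point \<phi> \<tau> \<and> \<tau> \<in> unit_disc \<and> spectral_value \<phi> \<tau> \<mu> \<and> Re \<mu> > 0 \<and>
        koenigs_function_elliptic \<phi> \<tau> \<mu> h \<and> z \<noteq> \<tau>"
    then have h: "h holomorphic_on unit_disc" "inj_on h unit_disc" "h \<tau> = 0"
        "\<And>t w. t \<ge> 0 \<Longrightarrow> w \<in> unit_disc \<Longrightarrow> h (\<phi> t w) = exp (- \<mu> * of_real t) * h w"
      by (auto simp: koenigs_function_elliptic_def)
    \<comment> \<open>This is where \<open>z \<noteq> \<tau>\<close> enters: it makes the constant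
      \<open>K\<close> positive.\<close>
    have hz: "h z \<noteq> 0" using inj_onD[OF h(2), of z \<tau>] h(3) * assms(3) by auto
    have mu: "\<mu> \<noteq> 0" using * by auto
    have der: "((\<lambda>t. exp (\<mu> * of_real t) * h z) has_vector_derivative
        \<mu> * exp (\<mu> * of_real t) * h z) (at t)" for t :: real
    proof -
      have "((\<lambda>x. exp (\<mu> * x) * h z) has_field_derivative \<mu> * exp (\<mu> * of_real t) * h z)
          (at (of_real t))"
        by (auto intro!: derivative_eq_intros)
      then show ?thesis by (rule has_vector_derivative_real_field)
    qed
    have conj: "h (\<phi> t w) = h z \<longleftrightarrow> h w = exp (\<mu> * of_real t) * h z"
      if "t \<ge> 0" "w \<in> unit_disc" for t w
      unfolding h(4)[OF that] by (auto simp: exp_minus field_simps)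
    show "(\<exists>C>0. C-lipschitz_on (backward_interval \<phi> z) (backward_orbit \<phi> z)) \<longleftrightarrow>
       Limsup (real_at_left (backward_time \<phi> z))
         (\<lambda>t. ereal (exp (Re \<mu> * t) * hyperbolic_density \<Omega> (exp (\<mu> * of_real t) * h z) /
                exp (2 * hyperbolic_distance \<Omega> (h z) (exp (\<mu> * of_real t) * h z)))) < \<infinity>"
      unfolding assms(2)
    \<comment> \<open>The speed of the spiral is
      \<open>norm \<mu> * norm (h z) * exp (Re \<mu> * t)\<close>. Its constant part is
      \<open>K\<close>; the exponential is \<open>k t\<close> and accounts for the extra factor in
      the elliptic criterion.\<close>
    proof (rule backward_orbit_lipschitz_iff[where p = "\<lambda>t. exp (\<mu> * of_real t) * h z"
          and p' = "\<lambda>t. \<mu> * exp (\<mu> * of_real t) * h z" and K = "norm \<mu> * norm (h z)"])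
      show "continuous_on UNIV (\<lambda>t. \<mu> * exp (\<mu> * of_real t) * h z)"
        by (intro continuous_intros)
      show "((\<lambda>t. exp (\<mu> * of_real t) * h z) has_vector_derivative
          \<mu> * exp (\<mu> * of_real t) * h z) (at t)" for t :: real
        by (rule der)
      show "norm \<mu> * norm (h z) > 0" using mu hz by simp
    qed (use im h(1,2) conj assms(3) in \<open>auto simp: norm_mult\<close>)
  }
qed

end
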